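(* Let $n\in\{4,6,8\}$, let $\boldsymbol v^0$ be the $n$-fold cyclic field of the context at the symmetric phases $\boldsymbol\xi=(-\tfrac{\pi}{4},\tfrac{\pi}{4},\dots,\tfrac{\pi}{4})$ and let $\boldsymbol g^0$ be its convective field, with its degree decomposition $g_i^0=g_i^{0b}+g_i^{0m}$. Then $\boldsymbol g^0$ is curl-free (and the symmetric construction therefore yields an unforced Navier--Stokes solution $\boldsymbol v=\boldsymbol v^0e^{-n\alpha^2\kappa t}$) if and only if $n=4$. At $n=4$ the higher-order multilinear part $\boldsymbol g^{0m}$ vanishes identically; at $n=6$ and $n=8$ it is nonzero and has non-vanishing curl, and no single-valued pressure $p$ with $\nabla p=-\rho\,\boldsymbol g^0$ exists.
   Context: Take $\alpha=v_r=1$ (the general case follows by scaling); $\rho,\kappa>0$ are density and viscosity. For an integer $m$ put $\langle m\rangle=((m-1)\bmod n)+1$. For $\boldsymbol\xi\in\mathbb R^n$, $$\mathcal T1_i^0=\prod_{k=1}^{n}\tau_k(\alpha x_{\langle i+k-1\rangle}+\xi_k),\quad \tau_k=\sin\ (k\text{ odd}),\ \cos\ (k\text{ even}),$$ $$\mathcal T2_i^0=\sin(\alpha x_i+\xi_2)\prod_{k=2}^{n-1}\sigma_k(\alpha x_{\langle i+k-1\rangle}+\xi_{k+1})\,\cos(\alpha x_{\langle i+n-1\rangle}+\xi_1),\quad\sigma_k=\cos\ (k\text{ odd}),\ \sin\ (k\text{ even}),$$ $v_i^0=v_r(\mathcal T1_i^0-\mathcal T2_i^0)$, and $g_i^0=\sum_jv_j^0\,\partial_jv_i^0$.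 A field $\boldsymbol w$ is curl-free if $\partial_jw_i=\partial_iw_j$ for all $i,j$. Degree decomposition: each $g_i^0$ is written in multiple-angle form as a sum of monomials in $\sin 2x_k,\cos2x_k$ (with at most one factor per coordinate); $g_i^{0b}$ is the part of degree two (one harmonic in $x_i$ and one in a second coordinate), and $g_i^{0m}$ is everything of higher degree. The unforced Navier--Stokes equations are $\partial_tv_i+\sum_jv_j\partial_jv_i=\kappa\Delta v_i-\rho^{-1}\partial_ip$, $\nabla\cdot\boldsymbol v=0$. *)

theory Defs
  imports "HOL-Analysis.Analysis"
begin

text \<open>
  A point of \<open>\<real>\<^sup>n\<close> is a function \<open>x :: nat \<Rightarrow> real\<close> of which only the coordinates
  \<open>x 1, \<dots>, x n\<close> matter; a vector field is a family of scalar fields indexed by \<open>{1..n}\<close>.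
\<close>

type_synonym point = "nat \<Rightarrow> real"

definition has_partial :: "nat \<Rightarrow> (point \<Rightarrow> real) \<Rightarrow> real \<Rightarrow> point \<Rightarrow> bool" where
  "has_partial j f D x \<longleftrightarrow> ((\<lambda>s. f (x(j := s))) has_real_derivative D) (at (x j))"

definition partial :: "nat \<Rightarrow> (point \<Rightarrow> real) \<Rightarrow> point \<Rightarrow> real" where
  "partial j f x = deriv (\<lambda>s. f (x(j := s))) (x j)"

definition curl_free :: "nat \<Rightarrow> (nat \<Rightarrow> point \<Rightarrow> real) \<Rightarrow> bool" where
  "curl_free n w \<longleftrightarrow> (\<forall>i\<in>{1..n}. \<forall>j\<in>{1..n}. \<forall>x. partial j (w i) x = partial i (w j) x)"

text \<open>
  Unforced Navier--Stokes equations on \<open>\<real>\<^sup>n\<close> for times \<open>t \<ge> 0\<close> (one-sided time derivative at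
  \<open>t = 0\<close>), with the existence of all derivatives that occur. The velocity is \<open>v i t x\<close>, the
  pressure \<open>p t x\<close>.
\<close>

definition navier_stokes ::
  "nat \<Rightarrow> real \<Rightarrow> real \<Rightarrow> (nat \<Rightarrow> real \<Rightarrow> point \<Rightarrow> real) \<Rightarrow> (real \<Rightarrow> point \<Rightarrow> real) \<Rightarrow> bool" where
  "navier_stokes n \<rho> \<kappa> v p \<longleftrightarrow>
    (\<forall>t\<ge>0. \<forall>x.
      (\<forall>i\<in>{1..n}. \<forall>j\<in>{1..n}.
         (\<exists>D. has_partial j (v i t) D x) \<and> (\<exists>D. has_partial j (partial j (v i t)) D x)) \<and>
      (\<forall>i\<in>{1..n}. \<exists>vt px.
         ((\<lambda>s. v i s x) has_real_derivative vt) (at t within {0..}) \<and>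
         has_partial i (p t) px x \<and>
         vt + (\<Sum>j=1..n. v j t x * partial j (v i t) x)
           = \<kappa> * (\<Sum>j=1..n. partial j (partial j (v i t)) x) - px / \<rho>) \<and>
      (\<Sum>i=1..n. partial i (v i t) x) = 0)"

text \<open>The representative of \<open>m\<close> modulo \<open>n\<close> in \<open>{1..n}\<close>; it is only used for \<open>m \<ge> 1\<close>.\<close>

definition cyc :: "nat \<Rightarrow> nat \<Rightarrow> nat" where
  "cyc n m = (m - 1) mod n + 1"

definition T1 :: "nat \<Rightarrow> real \<Rightarrow> (nat \<Rightarrow> real) \<Rightarrow> nat \<Rightarrow> point \<Rightarrow> real" where
  "T1 n \<alpha> \<xi> i x =
    (\<Prod>k=1..n. (if odd k then sin else cos) (\<alpha> * x (cyc n (i + k - 1)) + \<xi> k))"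

definition T2 :: "nat \<Rightarrow> real \<Rightarrow> (nat \<Rightarrow> real) \<Rightarrow> nat \<Rightarrow> point \<Rightarrow> real" where
  "T2 n \<alpha> \<xi> i x =
    sin (\<alpha> * x i + \<xi> 2) *
    (\<Prod>k=2..n-1. (if odd k then cos else sin) (\<alpha> * x (cyc n (i + k - 1)) + \<xi> (k + 1))) *
    cos (\<alpha> * x (cyc n (i + n - 1)) + \<xi> 1)"

definition v0 :: "nat \<Rightarrow> real \<Rightarrow> real \<Rightarrow> (nat \<Rightarrow> real) \<Rightarrow> nat \<Rightarrow> point \<Rightarrow> real" where
  "v0 n \<alpha> vr \<xi> i x = vr * (T1 n \<alpha> \<xi> i x - T2 n \<alpha> \<xi> i x)"

definition g0 :: "nat \<Rightarrow> real \<Rightarrow> real \<Rightarrow> (nat \<Rightarrow> real) \<Rightarrow> nat \<Rightarrow> point \<Rightarrow> real" where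
  "g0 n \<alpha> vr \<xi> i x = (\<Sum>j=1..n. v0 n \<alpha> vr \<xi> j x * partial j (v0 n \<alpha> vr \<xi> i) x)"

definition sym_phase :: "nat \<Rightarrow> real" where
  "sym_phase k = (if k = 1 then - (pi / 4) else pi / 4)"

text \<open>
  Multiple-angle form. The pair \<open>(S, C)\<close> of disjoint subsets of \<open>{1..n}\<close> encodes the monomial
  \<open>(\<Prod>k\<in>S. sin (2 \<alpha> x\<^sub>k)) (\<Prod>k\<in>C. cos (2 \<alpha> x\<^sub>k))\<close>; disjointness says that each coordinate
  contributes at most one factor.
\<close>

definition monomials :: "nat \<Rightarrow> (nat set \<times> nat set) set" where
  "monomials n = {(S, C). S \<subseteq> {1..n} \<and> C \<subseteq> {1..n} \<and> S \<inter> C = {}}"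

definition monomial :: "real \<Rightarrow> nat set \<times> nat set \<Rightarrow> point \<Rightarrow> real" where
  "monomial \<alpha> m x = (\<Prod>k\<in>fst m. sin (2 * \<alpha> * x k)) * (\<Prod>k\<in>snd m. cos (2 * \<alpha> * x k))"

definition mdegree :: "nat set \<times> nat set \<Rightarrow> nat" where
  "mdegree m = card (fst m) + card (snd m)"

definition multiple_angle_form ::
  "nat \<Rightarrow> real \<Rightarrow> (point \<Rightarrow> real) \<Rightarrow> (nat set \<times> nat set \<Rightarrow> real) \<Rightarrow> bool" where
  "multiple_angle_form n \<alpha> f c \<longleftrightarrow>
    (\<forall>m. m \<notin> monomials n \<longrightarrow> c m = 0) \<and>
    (\<forall>x. f x = (\<Sum>m\<in>monomials n. c m * monomial \<alpha> m x))"

definition multiple_angle_coeff ::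
  "nat \<Rightarrow> real \<Rightarrow> (point \<Rightarrow> real) \<Rightarrow> nat set \<times> nat set \<Rightarrow> real" where
  "multiple_angle_coeff n \<alpha> f = (THE c. multiple_angle_form n \<alpha> f c)"

text \<open>Degree two: one harmonic in \<open>x\<^sub>i\<close> and one in a second coordinate.\<close>

definition bilinear_part ::
  "nat \<Rightarrow> real \<Rightarrow> (nat \<Rightarrow> point \<Rightarrow> real) \<Rightarrow> nat \<Rightarrow> point \<Rightarrow> real" where
  "bilinear_part n \<alpha> g i x =
    (\<Sum>m\<in>{m \<in> monomials n. mdegree m = 2 \<and> i \<in> fst m \<union> snd m}.
       multiple_angle_coeff n \<alpha> (g i) m * monomial \<alpha> m x)"

definition multilinear_part ::
  "nat \<Rightarrow> real \<Rightarrow> (nat \<Rightarrow> point \<Rightarrow> real) \<Rightarrow> nat \<Rightarrow> point \<Rightarrow> real" where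
  "multilinear_part n \<alpha> g i x =
    (\<Sum>m\<in>{m \<in> monomials n. mdegree m > 2}.
       multiple_angle_coeff n \<alpha> (g i) m * monomial \<alpha> m x)"

end

theory Submission
  imports Defs
begin

text \<open>
  Write \<open>\<epsilon>\<^sub>k = (-1)\<^sup>k\<close> and \<open>\<theta>\<^sub>k = \<pi>/4 + \<epsilon>\<^sub>k \<alpha> x\<^sub>k\<close>. At the symmetric phases the alternation of sines and cosines is
  absorbed into the angles, and for every even \<open>n\<close> the field becomes symmetric in the coordinates
  (\<open>v0_sym_phase\<close>):
  \<open>v\<^sub>i = - v\<^sub>r (sin \<theta>\<^sub>i \<Prod>\<^bsub>k\<noteq>i\<^esub> cos \<theta>\<^sub>k + cos \<theta>\<^sub>i \<Prod>\<^bsub>k\<noteq>i\<^esub> sin \<theta>\<^sub>k)\<close>.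
  From this form the divergence vanishes and each component is an eigenfunction of the Laplacian, so the
  decaying field solves the Navier--Stokes equations with some pressure exactly if \<open>- \<rho> g\<close> is a gradient
  (\<open>navier_stokes_iff_gradient\<close>).

  The convective field has a closed multiple-angle form (\<open>g0_sym_phase\<close>). With \<open>\<epsilon>(U) = \<Sum>\<^bsub>k\<in>U\<^esub> \<epsilon>\<^sub>k\<close>,
  \<open>g\<^sub>i = cos (2\<alpha>x\<^sub>i) \<Sum>\<^sub>S c\<^sub>i(S) \<Prod>\<^bsub>k\<in>S\<^esub> sin (2\<alpha>x\<^sub>k)\<close>, \<open>c\<^sub>i(S) = - \<alpha> v\<^sub>r\<^sup>2 2\<^bsup>2-n\<^esup> (\<Prod>\<^bsub>k\<in>S\<^esub> \<epsilon>\<^sub>k) \<epsilon>(S \<union> {i})\<close>,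
  where \<open>S\<close> runs over the sets of odd size that avoid \<open>i\<close>. Since the monomials are linearly independent
  (\<open>monomials_independent\<close>), this is the multiple-angle form, and its degrees can be read off: a set \<open>S\<close>
  contributes in degree \<open>card S + 1\<close>.

  The curl of such a field vanishes if and only if \<open>c\<^sub>i(T \<union> {j}) = c\<^sub>j(T \<union> {i})\<close> for all \<open>i \<noteq> j\<close> and all \<open>T\<close> avoiding both.
  This is automatic for \<open>\<epsilon>\<^sub>i = \<epsilon>\<^sub>j\<close>; for \<open>\<epsilon>\<^sub>i = - \<epsilon>\<^sub>j\<close> it says \<open>\<epsilon>(T) = 0\<close> for all \<open>T\<close> of even size avoiding \<open>i\<close> and \<open>j\<close>. For
  \<open>n = 4\<close> such a \<open>T\<close> is empty or consists of the two remaining coordinates, which have opposite signs, and an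
  explicit potential exists (\<open>trig_potential\<close>, \<open>conv_coeff_potential_4\<close>). The terms of degree above two belong
  to sets \<open>S\<close> of three elements, for which \<open>S \<union> {i}\<close> is everything and \<open>\<epsilon>(S \<union> {i}) = 0\<close>. For even \<open>n \<ge> 6\<close> the set
  \<open>T = {3, 5}\<close> violates the condition at \<open>i = 1\<close>, \<open>j = 2\<close>, and it does so with terms of degree four
  (\<open>not_curl_free_conv_coeff\<close>). Hence neither the field nor its higher-degree part is curl-free, the latter
  is nonzero, and by the symmetry of mixed differences no potential exists (\<open>trig_gradient_curl_free\<close>).
\<close>

section \<open>Curl and potential of products of one cosine with sines\<close>

text \<open>
  The convective field turns out to be of this shape in every component: one cosine harmonic, in the
  component's own coordinate, times a polynomial in the sine harmonics of the other coordinates that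
  is affine in each of them.
\<close>

definition trig_sum :: "nat \<Rightarrow> real \<Rightarrow> (nat set \<Rightarrow> real) \<Rightarrow> nat \<Rightarrow> point \<Rightarrow> real" where
  "trig_sum n \<alpha> c i x =
     cos (2 * \<alpha> * x i) * (\<Sum>S\<in>Pow ({1..n} - {i}). c S * (\<Prod>k\<in>S. sin (2 * \<alpha> * x k)))"

text \<open>
  The coefficient of \<open>sin (2 \<alpha> x\<^sub>j)\<close> in the second factor of \<^const>\<open>trig_sum\<close>. Up to a factor symmetric in
  \<open>i\<close> and \<open>j\<close> it is the partial derivative of the \<open>i\<close>-th component in direction \<open>j\<close>.
\<close>

definition trig_mixed :: "nat \<Rightarrow> real \<Rightarrow> (nat set \<Rightarrow> real) \<Rightarrow> nat \<Rightarrow> nat \<Rightarrow> point \<Rightarrow> real" where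
  "trig_mixed n \<alpha> c i j x =
     (\<Sum>T\<in>Pow ({1..n} - {i, j}). c (insert j T) * (\<Prod>k\<in>T. sin (2 * \<alpha> * x k)))"

lemma sum_Pow_remove:
  fixes f :: "'a set \<Rightarrow> real"
  assumes "finite A" "j \<in> A"
  shows "(\<Sum>S\<in>Pow A. f S) = (\<Sum>T\<in>Pow (A - {j}). f T) + (\<Sum>T\<in>Pow (A - {j}). f (insert j T))"
proof -
  have "Pow A = Pow (A - {j}) \<union> insert j ` Pow (A - {j})"
    using assms(2) Pow_insert[of j "A - {j}"] by (simp add: insert_absorb)
  moreover have "inj_on (insert j) (Pow (A - {j}))"
    by (auto simp: inj_on_def)
  moreover have "Pow (A - {j}) \<inter> insert j ` Pow (A - {j}) = {}" by auto
  ultimately show ?thesis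
    using assms(1) by (simp add: sum.union_disjoint sum.reindex)
qed

lemma prod_sin_upd:
  "j \<notin> T \<Longrightarrow> (\<Prod>k\<in>T. sin (2 * \<alpha> * (x(j := s)) k)) = (\<Prod>k\<in>T. sin (2 * \<alpha> * x k))"
  by (intro prod.cong) auto

lemma trig_mixed_upd:
  assumes "l = i \<or> l = j"
  shows "trig_mixed n \<alpha> c i j (x(l := s)) = trig_mixed n \<alpha> c i j x"
  unfolding trig_mixed_def
  using assms by (intro sum.cong refl arg_cong2[where f="(*)"] prod_sin_upd) auto

lemma trig_sum_split:
  assumes "j \<in> {1..n}" "j \<noteq> i"
  shows "trig_sum n \<alpha> c i x = cos (2 * \<alpha> * x i) *
    ((\<Sum>T\<in>Pow ({1..n} - {i, j}). c T * (\<Prod>k\<in>T. sin (2 * \<alpha> * x k)))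
      + trig_mixed n \<alpha> c i j x * sin (2 * \<alpha> * x j))"
proof -
  have minus: "{1..n} - {i} - {j} = {1..n} - {i, j}" by auto
  have "(\<Prod>k\<in>insert j T. sin (2 * \<alpha> * x k)) = sin (2 * \<alpha> * x j) * (\<Prod>k\<in>T. sin (2 * \<alpha> * x k))"
    if "T \<in> Pow ({1..n} - {i, j})" for T
    using that by (subst prod.insert) (auto intro: finite_subset)
  then have "(\<Sum>T\<in>Pow ({1..n} - {i, j}). c (insert j T) * (\<Prod>k\<in>insert j T. sin (2 * \<alpha> * x k)))
    = (\<Sum>T\<in>Pow ({1..n} - {i, j}). c (insert j T) * (sin (2 * \<alpha> * x j) * (\<Prod>k\<in>T. sin (2 * \<alpha> * x k))))"
    by (intro sum.cong refl arg_cong2[where f="(*)"])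
  moreover have "(\<Sum>S\<in>Pow ({1..n} - {i}). c S * (\<Prod>k\<in>S. sin (2 * \<alpha> * x k)))
    = (\<Sum>T\<in>Pow ({1..n} - {i, j}). c T * (\<Prod>k\<in>T. sin (2 * \<alpha> * x k)))
      + (\<Sum>T\<in>Pow ({1..n} - {i, j}). c (insert j T) * (\<Prod>k\<in>insert j T. sin (2 * \<alpha> * x k)))"
    using assms sum_Pow_remove[of "{1..n} - {i}" j] unfolding minus by simp
  ultimately show ?thesis
    unfolding trig_sum_def trig_mixed_def
    by (simp add: sum_distrib_left mult_ac)
qed

lemma partial_trig_sum:
  assumes "j \<in> {1..n}" "j \<noteq> i"
  shows "partial j (trig_sum n \<alpha> c i) x
    = 2 * \<alpha> * cos (2 * \<alpha> * x i) * cos (2 * \<alpha> * x j) * trig_mixed n \<alpha> c i j x"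
proof -
  let ?A = "\<Sum>T\<in>Pow ({1..n} - {i, j}). c T * (\<Prod>k\<in>T. sin (2 * \<alpha> * x k))"
  have A: "(\<Sum>T\<in>Pow ({1..n} - {i, j}). c T * (\<Prod>k\<in>T. sin (2 * \<alpha> * (x(j := s)) k))) = ?A" for s
    by (intro sum.cong refl arg_cong2[where f="(*)"] prod_sin_upd) auto
  have "trig_sum n \<alpha> c i (x(j := s)) =
      cos (2 * \<alpha> * x i) * (?A + trig_mixed n \<alpha> c i j x * sin (2 * \<alpha> * s))" for s
    unfolding trig_sum_split[OF assms] A using assms by (simp add: trig_mixed_upd)
  then show ?thesis
    unfolding partial_def
    by (auto intro!: DERIV_imp_deriv derivative_eq_intros)
qed

text \<open>
  Along the \<open>i\<close>-th axis the component \<open>trig_sum n \<alpha> c i\<close> has an explicit antiderivative, so the increments of \<open>p\<close>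
  in direction \<open>i\<close> are known from the existence of \<open>has_partial i p\<close> alone. The alternating sum of \<open>p\<close> over
  the corners of a rectangle in the plane of \<open>x\<^sub>i\<close> and \<open>x\<^sub>j\<close> removes the terms that do not involve \<open>x\<^sub>j\<close>.
\<close>

lemma trig_sum_rectangle:
  assumes "\<alpha> \<noteq> 0" and ij: "i \<in> {1..n}" "j \<in> {1..n}" "i \<noteq> j"
    and p: "\<And>x. has_partial i p (trig_sum n \<alpha> c i x) x"
  shows "2 * \<alpha> * (p (x(i := s, j := t)) - p (x(i := 0, j := t)) - p (x(i := s, j := 0)) + p (x(i := 0, j := 0)))
    = trig_mixed n \<alpha> c i j x * sin (2 * \<alpha> * s) * sin (2 * \<alpha> * t)"
proof -
  let ?A = "\<Sum>T\<in>Pow ({1..n} - {i, j}). c T * (\<Prod>k\<in>T. sin (2 * \<alpha> * x k))"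
  let ?D = "trig_mixed n \<alpha> c i j x"
  have A: "(\<Sum>T\<in>Pow ({1..n} - {i, j}). c T * (\<Prod>k\<in>T. sin (2 * \<alpha> * (x(i := a, j := b)) k))) = ?A" for a b
    by (intro sum.cong refl arg_cong2[where f="(*)"] prod.cong) auto
  have g: "trig_sum n \<alpha> c i (x(i := a, j := b)) = cos (2 * \<alpha> * a) * (?A + ?D * sin (2 * \<alpha> * b))" for a b
    unfolding trig_sum_split[OF ij(2) ij(3)[symmetric]] A using ij by (simp add: trig_mixed_upd)
  have increment: "2 * \<alpha> * (p (x(i := a, j := b)) - p (x(i := 0, j := b)))
      = sin (2 * \<alpha> * a) * (?A + ?D * sin (2 * \<alpha> * b))" for a b
  proof -
    let ?q = "\<lambda>a. 2 * \<alpha> * p (x(i := a, j := b)) - sin (2 * \<alpha> * a) * (?A + ?D * sin (2 * \<alpha> * b))"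
    have "((\<lambda>a. p (x(i := a, j := b))) has_real_derivative
        cos (2 * \<alpha> * a) * (?A + ?D * sin (2 * \<alpha> * b))) (at a)" for a
      using p[of "x(i := a, j := b)"] ij(3) unfolding has_partial_def g
      by (simp add: fun_upd_twist[of i j])
    then have "(?q has_real_derivative 0) (at a)" for a
      by (auto intro!: derivative_eq_intros)
    then have "?q a = ?q 0"
      using DERIV_isconst_all[of ?q a 0] by blast
    then show ?thesis by (simp add: algebra_simps)
  qed
  show ?thesis
    using increment[of s t] increment[of s 0] by (simp add: algebra_simps)
qed

text \<open>
  Schwarz's theorem for a \<open>p\<close> of which only the partial derivatives are known to exist: the alternating
  corner sum can be computed by integrating first along axis \<open>i\<close> or first along axis \<open>j\<close>, and comparing the
  two results equates the mixed coefficients.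
\<close>

lemma trig_gradient_curl_free:
  assumes "\<alpha> \<noteq> 0"
    and p: "\<And>i x. i \<in> {1..n} \<Longrightarrow> has_partial i p (trig_sum n \<alpha> (c i) i x) x"
  shows "curl_free n (\<lambda>i. trig_sum n \<alpha> (c i) i)"
  unfolding curl_free_def
proof (intro ballI allI)
  fix i j x assume ij: "i \<in> {1..n}" "j \<in> {1..n}"
  show "partial j (trig_sum n \<alpha> (c i) i) x = partial i (trig_sum n \<alpha> (c j) j) x"
  proof (cases "i = j")
    case False
    let ?s = "pi / (4 * \<alpha>)"
    have "2 * \<alpha> * ?s = pi / 2" using assms(1) by (simp add: field_simps)
    then have sin_s: "sin (2 * \<alpha> * ?s) = 1" by (simp only: sin_pi_half)
    have "trig_mixed n \<alpha> (c i) i j x = trig_mixed n \<alpha> (c j) j i x"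
      using trig_sum_rectangle[OF assms(1) ij False p[OF ij(1)], of x ?s ?s]
        trig_sum_rectangle[OF assms(1) ij(2,1) False[symmetric] p[OF ij(2)], of x ?s ?s] False
      unfolding sin_s by (simp add: fun_upd_twist[of i j] algebra_simps)
    then show ?thesis
      using ij False by (simp add: partial_trig_sum)
  qed simp
qed

text \<open>
  A potential exists as soon as the coefficient at \<open>S\<close> of component \<open>i\<close> depends only on \<open>insert i S\<close>:
  differentiating \<open>sin (2 \<alpha> x\<^sub>i)\<close> in the monomial of \<open>insert i S\<close> produces the cosine of component \<open>i\<close> and leaves the
  monomial of \<open>S\<close>.
\<close>

lemma trig_potential:
  assumes "\<alpha> \<noteq> 0" "i \<in> {1..n}"
    and c: "\<And>S. S \<subseteq> {1..n} - {i} \<Longrightarrow> c S = C (insert i S)"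
  shows "has_partial i (\<lambda>x. (\<Sum>U\<in>Pow {1..n}. C U * (\<Prod>k\<in>U. sin (2 * \<alpha> * x k))) / (2 * \<alpha>))
    (trig_sum n \<alpha> c i x) x"
proof -
  let ?A = "\<Sum>T\<in>Pow ({1..n} - {i}). C T * (\<Prod>k\<in>T. sin (2 * \<alpha> * x k))"
  let ?D = "\<Sum>T\<in>Pow ({1..n} - {i}). c T * (\<Prod>k\<in>T. sin (2 * \<alpha> * x k))"
  have P: "(\<Prod>k\<in>insert i T. sin (2 * \<alpha> * (x(i := s)) k)) = sin (2 * \<alpha> * s) * (\<Prod>k\<in>T. sin (2 * \<alpha> * x k))"
    if "T \<in> Pow ({1..n} - {i})" for T s
    using that prod_sin_upd[of i T \<alpha> x s] by (subst prod.insert) (auto intro: finite_subset)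
  have Q: "(\<Prod>k\<in>T. sin (2 * \<alpha> * (x(i := s)) k)) = (\<Prod>k\<in>T. sin (2 * \<alpha> * x k))"
    if "T \<in> Pow ({1..n} - {i})" for T s
    using that by (intro prod_sin_upd) auto
  have "(\<Sum>U\<in>Pow {1..n}. C U * (\<Prod>k\<in>U. sin (2 * \<alpha> * (x(i := s)) k))) = ?A + ?D * sin (2 * \<alpha> * s)" for s
  proof -
    have "(\<Sum>U\<in>Pow {1..n}. C U * (\<Prod>k\<in>U. sin (2 * \<alpha> * (x(i := s)) k)))
      = (\<Sum>T\<in>Pow ({1..n} - {i}). C T * (\<Prod>k\<in>T. sin (2 * \<alpha> * (x(i := s)) k)))
      + (\<Sum>T\<in>Pow ({1..n} - {i}). C (insert i T) * (\<Prod>k\<in>insert i T. sin (2 * \<alpha> * (x(i := s)) k)))"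
      using assms(2) by (intro sum_Pow_remove) auto
    also have "\<dots> = ?A + (\<Sum>T\<in>Pow ({1..n} - {i}). c T * (sin (2 * \<alpha> * s) * (\<Prod>k\<in>T. sin (2 * \<alpha> * x k))))"
      by (intro arg_cong2[where f="(+)"] sum.cong refl arg_cong2[where f="(*)"] P Q c[symmetric]) auto
    also have "(\<Sum>T\<in>Pow ({1..n} - {i}). c T * (sin (2 * \<alpha> * s) * (\<Prod>k\<in>T. sin (2 * \<alpha> * x k))))
      = ?D * sin (2 * \<alpha> * s)"
      by (simp add: sum_distrib_left mult_ac)
    finally show ?thesis .
  qed
  then show ?thesis
    unfolding has_partial_def trig_sum_def using assms(1)
    by (auto intro!: derivative_eq_intros)
qed

text \<open>
  At the points where every sine harmonic is \<open>0\<close> or \<open>1\<close> a mixed coefficient is a finite sum of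
  coefficients of the field, so that curls can be tested by pure combinatorics.
\<close>

lemma trig_mixed_at_corner:
  assumes "\<alpha> \<noteq> 0" "A \<subseteq> {1..n} - {i, j}"
  shows "trig_mixed n \<alpha> c i j (\<lambda>k. if k \<in> A then pi / (4 * \<alpha>) else 0) = (\<Sum>T\<in>Pow A. c (insert j T))"
proof -
  have angle: "2 * \<alpha> * (pi / (4 * \<alpha>)) = pi / 2" using assms(1) by (simp add: field_simps)
  have *: "sin (2 * \<alpha> * (if k \<in> A then pi / (4 * \<alpha>) else 0)) = (if k \<in> A then 1 else 0)" for k
    by (cases "k \<in> A") (simp_all only: angle if_True if_False sin_pi_half mult_zero_right sin_zero)
  have "(\<Prod>k\<in>T. if k \<in> A then 1 else 0 :: real) = (if T \<subseteq> A then 1 else 0)"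
    if "T \<in> Pow ({1..n} - {i, j})" for T
  proof (cases "T \<subseteq> A")
    case True
    then show ?thesis by (simp add: subset_iff)
  next
    case False
    then obtain k where "k \<in> T" "k \<notin> A" by auto
    moreover have "finite T" using that by (auto intro: finite_subset)
    ultimately show ?thesis using False by auto
  qed
  then have "trig_mixed n \<alpha> c i j (\<lambda>k. if k \<in> A then pi / (4 * \<alpha>) else 0)
      = (\<Sum>T\<in>Pow ({1..n} - {i, j}). if T \<in> Pow A then c (insert j T) else 0)"
    unfolding trig_mixed_def * by (intro sum.cong) auto
  also have "\<dots> = (\<Sum>T\<in>Pow A. c (insert j T))"
    using assms(2) by (subst sum.inter_restrict[symmetric]) (auto intro!: sum.cong)
  finally show ?thesis .
qed

section \<open>Uniqueness of the multiple-angle form and its degrees\<close>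

definition disjoint_pairs :: "nat set \<Rightarrow> (nat set \<times> nat set) set" where
  "disjoint_pairs A = {(S, C). S \<subseteq> A \<and> C \<subseteq> A \<and> S \<inter> C = {}}"

lemma finite_disjoint_pairs: "finite A \<Longrightarrow> finite (disjoint_pairs A)"
  by (rule finite_subset[of _ "Pow A \<times> Pow A"]) (auto simp: disjoint_pairs_def)

lemma disjoint_pairs_insert:
  assumes "k \<notin> A"
  shows "disjoint_pairs (insert k A) = disjoint_pairs A
    \<union> (map_prod (insert k) id ` disjoint_pairs A \<union> map_prod id (insert k) ` disjoint_pairs A)"
proof (intro equalityI subsetI)
  fix m assume m: "m \<in> disjoint_pairs (insert k A)"
  obtain S C where [simp]: "m = (S, C)" by (cases m)
  have SC: "S \<subseteq> insert k A" "C \<subseteq> insert k A" "S \<inter> C = {}" using m by (auto simp: disjoint_pairs_def)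
  consider "k \<in> S" "k \<notin> C" | "k \<notin> S" "k \<in> C" | "k \<notin> S" "k \<notin> C" using SC(3) by blast
  then show "m \<in> disjoint_pairs A
    \<union> (map_prod (insert k) id ` disjoint_pairs A \<union> map_prod id (insert k) ` disjoint_pairs A)"
  proof cases
    case 1
    then have "m = map_prod (insert k) id (S - {k}, C)" "(S - {k}, C) \<in> disjoint_pairs A"
      using SC by (auto simp: disjoint_pairs_def)
    then show ?thesis by blast
  next
    case 2
    then have "m = map_prod id (insert k) (S, C - {k})" "(S, C - {k}) \<in> disjoint_pairs A"
      using SC by (auto simp: disjoint_pairs_def)
    then show ?thesis by blast
  next
    case 3
    then show ?thesis using SC by (auto simp: disjoint_pairs_def)
  qed
qed (use assms in \<open>auto simp: disjoint_pairs_def\<close>)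

text \<open>
  Induction on the coordinates. On a line parallel to axis \<open>k\<close> the sum has the form
  \<open>f\<^sub>0 + f\<^sub>1 sin (2 \<alpha> s) + f\<^sub>2 cos (2 \<alpha> s)\<close> with \<open>f\<^sub>0\<close>, \<open>f\<^sub>1\<close>, \<open>f\<^sub>2\<close> sums over monomials in the remaining coordinates.
  The induction hypothesis applies for each fixed \<open>s\<close>; the angles \<open>0\<close>, \<open>\<pi> / 2\<close> and \<open>\<pi>\<close> then separate the three
  coefficients.
\<close>

lemma monomials_independent:
  assumes "\<alpha> \<noteq> 0" "finite A"
    and "\<And>x. (\<Sum>m\<in>disjoint_pairs A. c m * monomial \<alpha> m x) = 0"
    and "m \<in> disjoint_pairs A"
  shows "c m = 0"
  using assms(2-)
proof (induction A arbitrary: c m rule: finite_induct)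
  case empty
  have "disjoint_pairs {} = {({}, {})}" by (auto simp: disjoint_pairs_def)
  then show ?case using empty by (simp add: monomial_def)
next
  case (insert k A)
  let ?M = "disjoint_pairs A"
  let ?S = "map_prod (insert k) id :: nat set \<times> nat set \<Rightarrow> _"
  let ?C = "map_prod id (insert k) :: nat set \<times> nat set \<Rightarrow> _"
  have fin: "finite ?M" using insert.hyps by (simp add: finite_disjoint_pairs)
  have inj: "inj_on ?S ?M" "inj_on ?C ?M"
    using insert.hyps by (auto simp: inj_on_def disjoint_pairs_def)
  have sub: "fst m \<subseteq> A" "snd m \<subseteq> A" "finite (fst m)" "finite (snd m)" "k \<notin> fst m" "k \<notin> snd m"
    if "m \<in> ?M" for m
    using that insert.hyps by (auto simp: disjoint_pairs_def finite_subset[OF _ insert.hyps(1)])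
  have S: "monomial \<alpha> (?S m) x = sin (2 * \<alpha> * x k) * monomial \<alpha> m x" if "m \<in> ?M" for m x
    using sub[OF that] by (simp add: monomial_def)
  have C: "monomial \<alpha> (?C m) x = cos (2 * \<alpha> * x k) * monomial \<alpha> m x" if "m \<in> ?M" for m x
    using sub[OF that] by (simp add: monomial_def)
  have upd: "monomial \<alpha> m (x(k := s)) = monomial \<alpha> m x" if "m \<in> ?M" for m x s
    using sub[OF that] unfolding monomial_def
    by (intro arg_cong2[where f="(*)"] prod.cong) auto
  have split: "(\<Sum>m\<in>disjoint_pairs (insert k A). c m * monomial \<alpha> m x)
    = (\<Sum>m\<in>?M. (c m + c (?S m) * sin (2 * \<alpha> * x k) + c (?C m) * cos (2 * \<alpha> * x k)) * monomial \<alpha> m x)" for x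
  proof -
    have "?M \<inter> (?S ` ?M \<union> ?C ` ?M) = {}" "?S ` ?M \<inter> ?C ` ?M = {}"
      using insert.hyps by (auto simp: disjoint_pairs_def)
    then show ?thesis
      unfolding disjoint_pairs_insert[OF insert.hyps(2)] using fin inj
      by (simp add: sum.union_disjoint sum.reindex S C sum.distrib algebra_simps)
  qed
  have slice: "(\<Sum>m\<in>?M. (c m + c (?S m) * sin (2 * \<alpha> * s) + c (?C m) * cos (2 * \<alpha> * s)) * monomial \<alpha> m x) = 0"
    for x s
    using insert.prems(1)[of "x(k := s)"] unfolding split by (simp add: upd fun_upd_same cong: sum.cong del: fun_upd_apply)
  have vanish: "c m + c (?S m) * sin (2 * \<alpha> * s) + c (?C m) * cos (2 * \<alpha> * s) = 0" if "m \<in> ?M" for m s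
    using insert.IH[OF slice that] .
  have "c m = 0 \<and> c (?S m) = 0 \<and> c (?C m) = 0" if "m \<in> ?M" for m
  proof -
    have "2 * \<alpha> * (pi / (4 * \<alpha>)) = pi / 2" "2 * \<alpha> * (pi / (2 * \<alpha>)) = pi"
      using assms(1) by (simp_all add: field_simps)
    then show ?thesis
      using vanish[OF that, of 0] vanish[OF that, of "pi / (4 * \<alpha>)"] vanish[OF that, of "pi / (2 * \<alpha>)"]
      by (simp only: sin_pi_half cos_pi_half sin_pi cos_pi sin_zero cos_zero mult_zero_right) linarith
  qed
  then show ?case
    using insert.prems(2) unfolding disjoint_pairs_insert[OF insert.hyps(2)] by (elim UnE imageE) auto
qed

lemma monomials_eq: "monomials n = disjoint_pairs {1..n}"
  by (simp add: monomials_def disjoint_pairs_def)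

lemma multiple_angle_form_unique:
  assumes "\<alpha> \<noteq> 0" "multiple_angle_form n \<alpha> f c" "multiple_angle_form n \<alpha> f d"
  shows "c = d"
proof
  fix m
  have "(\<Sum>m\<in>disjoint_pairs {1..n}. (c m - d m) * monomial \<alpha> m x) = 0" for x
    using assms(2,3) by (simp add: multiple_angle_form_def monomials_eq left_diff_distrib sum_subtractf)
  then have "c m - d m = 0" if "m \<in> disjoint_pairs {1..n}"
    using monomials_independent[OF assms(1) finite_atLeastAtMost _ that, of "\<lambda>m. c m - d m"] by simp
  then show "c m = d m"
    using assms(2,3) unfolding multiple_angle_form_def monomials_eq
    by (metis eq_iff_diff_eq_0)
qed

lemma multiple_angle_coeff_eq:
  assumes "\<alpha> \<noteq> 0" "multiple_angle_form n \<alpha> f c"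
  shows "multiple_angle_coeff n \<alpha> f = c"
  unfolding multiple_angle_coeff_def
  using assms multiple_angle_form_unique by blast

text \<open>
  The multiple-angle coefficients of \<^const>\<open>trig_sum\<close>: the only cosine in any monomial is that of coordinate \<open>i\<close>.
\<close>

definition trig_coeff :: "nat \<Rightarrow> (nat set \<Rightarrow> real) \<Rightarrow> nat \<Rightarrow> nat set \<times> nat set \<Rightarrow> real" where
  "trig_coeff n c i m = (if snd m = {i} \<and> fst m \<subseteq> {1..n} - {i} then c (fst m) else 0)"

lemma sum_trig_coeff:
  assumes "i \<in> {1..n}"
  shows "(\<Sum>m\<in>{m \<in> monomials n. P m}. trig_coeff n c i m * monomial \<alpha> m x)
    = trig_sum n \<alpha> (\<lambda>S. if P (S, {i}) then c S else 0) i x"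
proof -
  have "(\<Sum>m\<in>{m \<in> monomials n. P m}. trig_coeff n c i m * monomial \<alpha> m x)
    = (\<Sum>m\<in>monomials n. (if P m then trig_coeff n c i m * monomial \<alpha> m x else 0))"
    by (intro sum.inter_filter) (simp add: monomials_eq finite_disjoint_pairs)
  also have "\<dots> = (\<Sum>m\<in>(\<lambda>S. (S, {i})) ` Pow ({1..n} - {i}). (if P m then trig_coeff n c i m * monomial \<alpha> m x else 0))"
    using assms
    by (intro sum.mono_neutral_right)
      (auto simp: monomials_eq disjoint_pairs_def trig_coeff_def intro: finite_disjoint_pairs[unfolded disjoint_pairs_def])
  also have "\<dots> = trig_sum n \<alpha> (\<lambda>S. if P (S, {i}) then c S else 0) i x"
    unfolding trig_sum_def sum_distrib_left
    by (subst sum.reindex) (auto simp: inj_on_def trig_coeff_def monomial_def intro!: sum.cong)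
  finally show ?thesis .
qed

lemma trig_sum_multiple_angle_form:
  assumes "i \<in> {1..n}"
  shows "multiple_angle_form n \<alpha> (trig_sum n \<alpha> c i) (trig_coeff n c i)"
  unfolding multiple_angle_form_def
proof (intro conjI allI impI)
  fix m assume "m \<notin> monomials n"
  then show "trig_coeff n c i m = 0"
    using assms by (cases m) (auto simp: trig_coeff_def monomials_def)
next
  fix x show "trig_sum n \<alpha> c i x = (\<Sum>m\<in>monomials n. trig_coeff n c i m * monomial \<alpha> m x)"
    using sum_trig_coeff[OF assms, where P="\<lambda>_. True"] by simp
qed

lemma bilinear_part_trig_sum:
  assumes "\<alpha> \<noteq> 0" "i \<in> {1..n}" "g i = trig_sum n \<alpha> c i"
  shows "bilinear_part n \<alpha> g i = trig_sum n \<alpha> (\<lambda>S. if card S = 1 then c S else 0) i"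
proof
  fix x
  show "bilinear_part n \<alpha> g i x = trig_sum n \<alpha> (\<lambda>S. if card S = 1 then c S else 0) i x"
    unfolding bilinear_part_def assms(3)
      multiple_angle_coeff_eq[OF assms(1) trig_sum_multiple_angle_form[OF assms(2)]]
      sum_trig_coeff[OF assms(2)]
    by (simp add: mdegree_def)
qed

lemma multilinear_part_trig_sum:
  assumes "\<alpha> \<noteq> 0" "i \<in> {1..n}" "g i = trig_sum n \<alpha> c i"
  shows "multilinear_part n \<alpha> g i = trig_sum n \<alpha> (\<lambda>S. if card S \<ge> 2 then c S else 0) i"
proof
  fix x
  have "Suc 0 < k \<longleftrightarrow> 2 \<le> k" for k by auto
  then show "multilinear_part n \<alpha> g i x = trig_sum n \<alpha> (\<lambda>S. if card S \<ge> 2 then c S else 0) i x"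
    unfolding multilinear_part_def assms(3)
      multiple_angle_coeff_eq[OF assms(1) trig_sum_multiple_angle_form[OF assms(2)]]
      sum_trig_coeff[OF assms(2)]
    by (simp add: mdegree_def)
qed

text \<open>
  Every monomial of \<^const>\<open>trig_sum\<close> contains the cosine of \<open>x\<^sub>i\<close>, so degree zero is absent, degree one is the
  coefficient at the empty set, and every monomial of degree two involves \<open>x\<^sub>i\<close>.
\<close>

lemma degree_decomposition_trig_sum:
  assumes "\<alpha> \<noteq> 0" "i \<in> {1..n}" "g i = trig_sum n \<alpha> c i" "c {} = 0"
  shows "g i x = bilinear_part n \<alpha> g i x + multilinear_part n \<alpha> g i x"
proof -
  have "c S = (if card S = 1 then c S else 0) + (if card S \<ge> 2 then c S else 0)"
    if "S \<in> Pow ({1..n} - {i})" for S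
  proof -
    have "finite S" using that by (auto intro: finite_subset)
    then have "card S = 0 \<longleftrightarrow> S = {}" by simp
    then show ?thesis using assms(4) by (cases "card S" rule: nat.exhaust) auto
  qed
  then have "(\<Sum>S\<in>Pow ({1..n} - {i}). c S * (\<Prod>k\<in>S. sin (2 * \<alpha> * x k)))
    = (\<Sum>S\<in>Pow ({1..n} - {i}). ((if card S = 1 then c S else 0) + (if card S \<ge> 2 then c S else 0)) * (\<Prod>k\<in>S. sin (2 * \<alpha> * x k)))"
    by (intro sum.cong refl arg_cong2[where f="(*)"]) auto
  then show ?thesis
    unfolding bilinear_part_trig_sum[OF assms(1,2), of g, OF assms(3)]
      multilinear_part_trig_sum[OF assms(1,2), of g, OF assms(3)] assms(3) trig_sum_def
    by (simp add: distrib_right sum.distrib distrib_left)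
qed

section \<open>The velocity field in symmetric form\<close>

text \<open>
  The sign of the angle alternates with the parity of the coordinate. By \<open>cos y = sin (\<pi> / 2 - y)\<close> this absorbs
  the alternation of sines and cosines in the definition of the field, which thereby becomes symmetric
  in all coordinates.
\<close>

definition sn :: "real \<Rightarrow> point \<Rightarrow> nat \<Rightarrow> real" where
  "sn \<alpha> x k = sin (pi / 4 + (-1) ^ k * (\<alpha> * x k))"

definition cs :: "real \<Rightarrow> point \<Rightarrow> nat \<Rightarrow> real" where
  "cs \<alpha> x k = cos (pi / 4 + (-1) ^ k * (\<alpha> * x k))"

lemma bij_betw_cyc:
  assumes "n > 0" "i \<in> {1..n}"
  shows "bij_betw (\<lambda>k. cyc n (i + k - 1)) {1..n} {1..n}"
proof -
  have inj: "inj_on (\<lambda>k. cyc n (i + k - 1)) {1..n}"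
  proof (rule inj_onI)
    fix k l assume kl: "k \<in> {1..n}" "l \<in> {1..n}" "cyc n (i + k - 1) = cyc n (i + l - 1)"
    obtain i' k' l' where [simp]: "i = Suc i'" "k = Suc k'" "l = Suc l'"
      using assms kl by (cases i; cases k; cases l) auto
    have "(i' + k') mod n = (i' + l') mod n" using kl(3) by (simp add: cyc_def)
    then have "n dvd k' - l'" "n dvd l' - k'"
      using mod_eq_dvd_iff_nat[of "i' + l'" "i' + k'" n] mod_eq_dvd_iff_nat[of "i' + k'" "i' + l'" n]
      by (metis add_diff_cancel_left nat_le_linear add_left_mono diff_is_0_eq dvd_0_right)+
    then have "k' - l' = 0" "l' - k' = 0"
      using kl(1,2) by (auto dest!: dvd_imp_le)
    then have "k' = l'" by simp
    then show "k = l" by simp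
  qed
  moreover have "(\<lambda>k. cyc n (i + k - 1)) ` {1..n} \<subseteq> {1..n}"
    using assms by (auto simp: cyc_def Suc_le_eq)
  ultimately show ?thesis
    by (simp add: bij_betw_def endo_inj_surj)
qed

lemma even_cyc:
  assumes "even n" "n > 0" "i \<ge> 1" "k \<ge> 1"
  shows "even (cyc n (i + k - 1)) \<longleftrightarrow> even (i + k + 1)"
proof -
  obtain i' k' where [simp]: "i = Suc i'" "k = Suc k'" using assms(3,4) by (cases i; cases k) auto
  have "even ((i' + k') mod n) \<longleftrightarrow> even (i' + k')"
    using assms(1) by (simp add: dvd_mod_iff)
  then show ?thesis by (simp add: cyc_def)
qed

lemma cyc_eq_self_iff:
  assumes "i \<in> {1..n}" "k \<in> {1..n}"
  shows "cyc n (i + k - 1) = i \<longleftrightarrow> k = 1"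
proof -
  have "cyc n (i + 1 - 1) = i" using assms by (auto simp: cyc_def)
  moreover have "n > 0" using assms(1) by simp
  ultimately show ?thesis
    using bij_betw_imp_inj_on[OF bij_betw_cyc[of n i]] assms unfolding inj_on_def
    by (metis atLeastAtMost_iff le_refl less_eq_Suc_le One_nat_def)
qed

lemma sn_alt: "sn \<alpha> x k = (if even k then sin (\<alpha> * x k + pi / 4) else cos (\<alpha> * x k + pi / 4))"
  by (cases "even k") (simp_all add: sn_def sin_add sin_diff cos_add cos_45 sin_45 mult.commute)

lemma cs_alt: "cs \<alpha> x k = (if even k then cos (\<alpha> * x k + pi / 4) else sin (\<alpha> * x k + pi / 4))"
  by (cases "even k") (simp_all add: cs_def sin_add cos_diff cos_add cos_45 sin_45 mult.commute)

lemma sin_sub_quarter: "sin (y - pi / 4) = - cos (y + pi / 4)"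
  by (simp add: sin_diff cos_add cos_45 sin_45 algebra_simps)

lemma cos_sub_quarter: "cos (y - pi / 4) = sin (y + pi / 4)"
  by (simp add: cos_diff sin_add cos_45 sin_45 algebra_simps)

lemma T1_sym_phase:
  assumes "even n" "i \<in> {1..n}"
  shows "T1 n \<alpha> sym_phase i x
    = - (if even i then cs \<alpha> x i * (\<Prod>k\<in>{1..n}-{i}. sn \<alpha> x k) else sn \<alpha> x i * (\<Prod>k\<in>{1..n}-{i}. cs \<alpha> x k))"
proof -
  let ?h = "\<lambda>l. if l = i then - (if even i then cs \<alpha> x i else sn \<alpha> x i)
    else (if even i then sn \<alpha> x l else cs \<alpha> x l)"
  have n: "n > 0" using assms(2) by simp
  have "T1 n \<alpha> sym_phase i x = (\<Prod>k=1..n. ?h (cyc n (i + k - 1)))"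
    unfolding T1_def
  proof (intro prod.cong refl)
    fix k assume k: "k \<in> {1..n}"
    show "(if odd k then sin else cos) (\<alpha> * x (cyc n (i + k - 1)) + sym_phase k) = ?h (cyc n (i + k - 1))"
      using cyc_eq_self_iff[OF assms(2) k] even_cyc[OF assms(1) n, of i k] k assms(2)
      by (cases "k = 1") (auto simp: sn_alt cs_alt sym_phase_def sin_sub_quarter)
  qed
  also have "\<dots> = (\<Prod>l=1..n. ?h l)"
    by (rule prod.reindex_bij_betw[OF bij_betw_cyc[OF n assms(2)]])
  also have "\<dots> = ?h i * (\<Prod>l\<in>{1..n}-{i}. ?h l)"
    using assms(2) by (intro prod.remove) auto
  also have "(\<Prod>l\<in>{1..n}-{i}. ?h l) = (\<Prod>l\<in>{1..n}-{i}. if even i then sn \<alpha> x l else cs \<alpha> x l)"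
    by (intro prod.cong) auto
  finally show ?thesis by simp
qed

lemma T2_sym_phase:
  assumes "even n" "i \<in> {1..n}"
  shows "T2 n \<alpha> sym_phase i x
    = (if even i then sn \<alpha> x i * (\<Prod>k\<in>{1..n}-{i}. cs \<alpha> x k) else cs \<alpha> x i * (\<Prod>k\<in>{1..n}-{i}. sn \<alpha> x k))"
proof -
  let ?h = "\<lambda>l. if (l = i) = even i then sn \<alpha> x l else cs \<alpha> x l"
  let ?f = "\<lambda>k. (if k = 1 \<or> even k then sin else cos) (\<alpha> * x (cyc n (i + k - 1)) + pi / 4)"
  have n: "n > 0" "n \<ge> 2" using assms by (auto elim: evenE)
  have i1: "cyc n i = i" using assms(2) by (auto simp: cyc_def)
  have "{1..n} = insert 1 (insert n {2..n-1})" using n by auto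
  then have "(\<Prod>k=1..n. ?f k) = ?f 1 * (?f n * (\<Prod>k=2..n-1. ?f k))"
    using n by simp
  also have "\<dots> = T2 n \<alpha> sym_phase i x"
  proof -
    have "(\<Prod>k=2..n-1. ?f k)
      = (\<Prod>k=2..n-1. (if odd k then cos else sin) (\<alpha> * x (cyc n (i + k - 1)) + sym_phase (k + 1)))"
      by (intro prod.cong) (auto simp: sym_phase_def)
    then show ?thesis
      unfolding T2_def using assms(1) i1 by (simp add: sym_phase_def cos_sub_quarter)
  qed
  finally have "T2 n \<alpha> sym_phase i x = (\<Prod>k=1..n. ?f k)" ..
  also have "\<dots> = (\<Prod>k=1..n. ?h (cyc n (i + k - 1)))"
  proof (intro prod.cong refl)
    fix k assume k: "k \<in> {1..n}"
    show "?f k = ?h (cyc n (i + k - 1))"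
      using cyc_eq_self_iff[OF assms(2) k] even_cyc[OF assms(1) n(1), of i k] k assms(2)
      by (cases "k = 1") (auto simp: sn_alt cs_alt)
  qed
  also have "\<dots> = (\<Prod>l=1..n. ?h l)"
    by (rule prod.reindex_bij_betw[OF bij_betw_cyc[OF n(1) assms(2)]])
  also have "\<dots> = ?h i * (\<Prod>l\<in>{1..n}-{i}. ?h l)"
    using assms(2) by (intro prod.remove) auto
  also have "(\<Prod>l\<in>{1..n}-{i}. ?h l) = (\<Prod>l\<in>{1..n}-{i}. if even i then cs \<alpha> x l else sn \<alpha> x l)"
    by (intro prod.cong) auto
  finally show ?thesis by simp
qed

text \<open>
  In terms of the shifted angles the two products of the definition, whose factors alternate cyclically
  starting from \<open>i\<close>, become the two terms of a formula in which no cyclic order is left; for even and odd \<open>i\<close>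
  they exchange their places.
\<close>

lemma v0_sym_phase:
  assumes "even n" "i \<in> {1..n}"
  shows "v0 n \<alpha> vr sym_phase i x
    = - vr * (sn \<alpha> x i * (\<Prod>k\<in>{1..n}-{i}. cs \<alpha> x k) + cs \<alpha> x i * (\<Prod>k\<in>{1..n}-{i}. sn \<alpha> x k))"
  unfolding v0_def T1_sym_phase[OF assms] T2_sym_phase[OF assms] by (simp add: algebra_simps)

section \<open>Derivatives of the velocity field\<close>

lemma sum_alternating_even:
  assumes "even n"
  shows "(\<Sum>k=1..n. (-1) ^ k :: real) = 0"
proof -
  obtain m where "n = 2 * m" using assms by auto
  moreover have "(\<Sum>k=1..2 * m. (-1) ^ k :: real) = 0" by (induction m) auto
  ultimately show ?thesis by simp
qed

text \<open>
  The field is linear in the pair \<open>sn \<alpha> x j\<close>, \<open>cs \<alpha> x j\<close>, for each \<open>j\<close> separately; the cofactors are its coefficients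
  and do not involve \<open>x\<^sub>j\<close>. Differentiating in direction \<open>j\<close> only rotates this pair.
\<close>

definition cofactor_sn :: "nat \<Rightarrow> real \<Rightarrow> real \<Rightarrow> nat \<Rightarrow> nat \<Rightarrow> point \<Rightarrow> real" where
  "cofactor_sn n \<alpha> vr i j x = - vr * (if j = i then \<Prod>k\<in>{1..n} - {i}. cs \<alpha> x k
     else cs \<alpha> x i * (\<Prod>k\<in>{1..n} - {i, j}. sn \<alpha> x k))"

definition cofactor_cs :: "nat \<Rightarrow> real \<Rightarrow> real \<Rightarrow> nat \<Rightarrow> nat \<Rightarrow> point \<Rightarrow> real" where
  "cofactor_cs n \<alpha> vr i j x = - vr * (if j = i then \<Prod>k\<in>{1..n} - {i}. sn \<alpha> x k
     else sn \<alpha> x i * (\<Prod>k\<in>{1..n} - {i, j}. cs \<alpha> x k))"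

lemma prod_remove_second:
  fixes f :: "nat \<Rightarrow> real"
  assumes "j \<in> {1..n}" "j \<noteq> i"
  shows "(\<Prod>k\<in>{1..n} - {i}. f k) = f j * (\<Prod>k\<in>{1..n} - {i, j}. f k)"
proof -
  have "{1..n} - {i} - {j} = {1..n} - {i, j}" by auto
  then show ?thesis using assms prod.remove[of "{1..n} - {i}" j f] by simp
qed

lemma v0_cofactors:
  assumes "even n" "i \<in> {1..n}" "j \<in> {1..n}"
  shows "v0 n \<alpha> vr sym_phase i x = cofactor_sn n \<alpha> vr i j x * sn \<alpha> x j + cofactor_cs n \<alpha> vr i j x * cs \<alpha> x j"
  unfolding v0_sym_phase[OF assms(1,2)] cofactor_sn_def cofactor_cs_def
  using prod_remove_second[OF assms(3)]
  by (cases "j = i") (simp_all add: algebra_simps)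

lemma sn_upd: "k \<noteq> j \<Longrightarrow> sn \<alpha> (x(j := s)) k = sn \<alpha> x k"
  and cs_upd: "k \<noteq> j \<Longrightarrow> cs \<alpha> (x(j := s)) k = cs \<alpha> x k"
  by (simp_all add: sn_def cs_def)

lemma cofactor_upd:
  "cofactor_sn n \<alpha> vr i j (x(j := s)) = cofactor_sn n \<alpha> vr i j x"
  "cofactor_cs n \<alpha> vr i j (x(j := s)) = cofactor_cs n \<alpha> vr i j x"
proof -
  have "(\<Prod>k\<in>A. sn \<alpha> (x(j := s)) k) = (\<Prod>k\<in>A. sn \<alpha> x k)"
    "(\<Prod>k\<in>A. cs \<alpha> (x(j := s)) k) = (\<Prod>k\<in>A. cs \<alpha> x k)" if "j \<notin> A" for A
    using that by (intro prod.cong refl sn_upd cs_upd; metis)+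
  then show "cofactor_sn n \<alpha> vr i j (x(j := s)) = cofactor_sn n \<alpha> vr i j x"
    "cofactor_cs n \<alpha> vr i j (x(j := s)) = cofactor_cs n \<alpha> vr i j x"
    unfolding cofactor_sn_def cofactor_cs_def by (auto simp: sn_upd cs_upd simp del: fun_upd_apply)
qed

lemma has_partial_sn: "has_partial j (\<lambda>x. sn \<alpha> x j) ((-1) ^ j * \<alpha> * cs \<alpha> x j) x"
  and has_partial_cs: "has_partial j (\<lambda>x. cs \<alpha> x j) (- ((-1) ^ j * \<alpha> * sn \<alpha> x j)) x"
  unfolding has_partial_def sn_def cs_def by (auto intro!: derivative_eq_intros)

lemma has_partial_imp_partial: "has_partial j f D x \<Longrightarrow> partial j f x = D"
  unfolding has_partial_def partial_def by (rule DERIV_imp_deriv)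

lemma has_partial_mult_const: "has_partial j f D x \<Longrightarrow> has_partial j (\<lambda>x. f x * c) (D * c) x"
  unfolding has_partial_def by (rule DERIV_cmult_right)

lemma has_partial_v0:
  assumes "even n" "i \<in> {1..n}" "j \<in> {1..n}"
  shows "has_partial j (v0 n \<alpha> vr sym_phase i)
    ((-1) ^ j * \<alpha> * (cofactor_sn n \<alpha> vr i j x * cs \<alpha> x j - cofactor_cs n \<alpha> vr i j x * sn \<alpha> x j)) x"
  using has_partial_sn[of j \<alpha> x] has_partial_cs[of j \<alpha> x]
  unfolding has_partial_def v0_cofactors[OF assms] cofactor_upd
  by (auto intro!: derivative_eq_intros simp: algebra_simps)

lemmas partial_v0 = has_partial_imp_partial[OF has_partial_v0]

lemma has_partial_partial_v0:
  assumes "even n" "i \<in> {1..n}" "j \<in> {1..n}"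
  shows "has_partial j (partial j (v0 n \<alpha> vr sym_phase i)) (- \<alpha>\<^sup>2 * v0 n \<alpha> vr sym_phase i x) x"
proof -
  have sq: "(-1) ^ j * ((-1) ^ j * y) = y" for y :: real
    by (simp add: power_mult_distrib[symmetric] mult.assoc[symmetric] flip: power_add)
  show ?thesis
    using has_partial_sn[of j \<alpha> x] has_partial_cs[of j \<alpha> x]
    unfolding has_partial_def partial_v0[OF assms] cofactor_upd v0_cofactors[OF assms]
    by (auto intro!: derivative_eq_intros simp: algebra_simps power2_eq_square sq)
qed

text \<open>
  The \<open>i\<close>-th term depends on \<open>i\<close> only through the sign \<open>(-1)\<^sup>i\<close>, and \<open>n\<close> is even.
\<close>

lemma divergence_v0:
  assumes "even n"
  shows "(\<Sum>i=1..n. partial i (v0 n \<alpha> vr sym_phase i) x) = 0"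
proof -
  have "partial i (v0 n \<alpha> vr sym_phase i) x
    = (-1) ^ i * (\<alpha> * vr * ((\<Prod>k=1..n. sn \<alpha> x k) - (\<Prod>k=1..n. cs \<alpha> x k)))" if "i \<in> {1..n}" for i
    using that prod.remove[of "{1..n}" i "sn \<alpha> x"] prod.remove[of "{1..n}" i "cs \<alpha> x"]
    unfolding partial_v0[OF assms that that] cofactor_sn_def cofactor_cs_def
    by (simp add: algebra_simps)
  then have "(\<Sum>i=1..n. partial i (v0 n \<alpha> vr sym_phase i) x)
    = (\<Sum>i=1..n. (-1) ^ i) * (\<alpha> * vr * ((\<Prod>k=1..n. sn \<alpha> x k) - (\<Prod>k=1..n. cs \<alpha> x k)))"
    by (simp add: sum_distrib_right)
  then show ?thesis using sum_alternating_even[OF assms] by simp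
qed

lemma double_angle_sn_cs:
  "(sn \<alpha> x k)\<^sup>2 = (1 + (-1) ^ k * sin (2 * \<alpha> * x k)) / 2"
  "(cs \<alpha> x k)\<^sup>2 = (1 - (-1) ^ k * sin (2 * \<alpha> * x k)) / 2"
  "sn \<alpha> x k * cs \<alpha> x k = cos (2 * \<alpha> * x k) / 2"
proof -
  define t where "t = pi / 4 + (-1) ^ k * (\<alpha> * x k)"
  have double: "2 * t = pi / 2 + (-1) ^ k * (2 * \<alpha> * x k)" by (simp add: t_def)
  have cos2: "cos (2 * t) = - ((-1) ^ k * sin (2 * \<alpha> * x k))"
    unfolding double by (cases "even k") (simp_all add: cos_add cos_diff)
  have sin2: "sin (2 * t) = cos (2 * \<alpha> * x k)"
    unfolding double by (cases "even k") (simp_all add: sin_add sin_diff)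
  have sn: "sn \<alpha> x k = sin t" and cs: "cs \<alpha> x k = cos t"
    by (simp_all add: sn_def cs_def t_def)
  show "(sn \<alpha> x k)\<^sup>2 = (1 + (-1) ^ k * sin (2 * \<alpha> * x k)) / 2"
    using cos2 unfolding sn cos_double_sin by simp
  show "(cs \<alpha> x k)\<^sup>2 = (1 - (-1) ^ k * sin (2 * \<alpha> * x k)) / 2"
    using cos2 unfolding cs cos_double_cos by simp
  show "sn \<alpha> x k * cs \<alpha> x k = cos (2 * \<alpha> * x k) / 2"
    using sin2 unfolding sn cs sin_double by simp
qed

text \<open>
  Reversing all signs multiplies the term of \<open>S\<close> by \<open>(-1)\<close> to the power \<open>card S\<close>, so the terms of even order cancel
  and those of odd order double.
\<close>

lemma prod_half_diff_expansion:
  fixes t d :: "nat \<Rightarrow> real"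
  assumes "finite A"
  shows "(\<Prod>k\<in>A. (1 + d k * t k) / 2) - (\<Prod>k\<in>A. (1 - d k * t k) / 2)
    = (\<Sum>S\<in>Pow A. (if odd (card S) then (\<Prod>k\<in>S. d k) * (\<Prod>k\<in>S. t k) else 0)) / 2 ^ card A * 2"
proof -
  have expand: "(\<Prod>k\<in>A. (1 + e * d k * t k) / 2)
    = (\<Sum>S\<in>Pow A. e ^ card S * ((\<Prod>k\<in>S. d k) * (\<Prod>k\<in>S. t k))) / 2 ^ card A" for e :: real
  proof -
    have "(\<Prod>k\<in>A. (1 + e * d k * t k) / 2) = (\<Prod>k\<in>A. e * d k * t k + 1) / 2 ^ card A"
      by (simp add: prod_dividef add.commute)
    then show ?thesis
      using assms by (simp add: prod_add prod.distrib mult.assoc)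
  qed
  show ?thesis
    using expand[of 1] expand[of "-1"]
    by (simp add: diff_divide_distrib[symmetric] sum_subtractf[symmetric] sum_distrib_right)
      (auto intro!: sum.cong)
qed

section \<open>The convective field\<close>

text \<open>
  The sum of signs is the number of even minus the number of odd elements of \<open>insert i S\<close>; all later
  arguments rest on this excess.
\<close>

definition conv_coeff :: "nat \<Rightarrow> real \<Rightarrow> real \<Rightarrow> nat \<Rightarrow> nat set \<Rightarrow> real" where
  "conv_coeff n \<alpha> vr i S = (if odd (card S)
     then - (\<alpha> * vr\<^sup>2 / 2 ^ (n - 2)) * (\<Prod>k\<in>S. (-1) ^ k) * (\<Sum>k\<in>insert i S. (-1) ^ k) else 0)"

text \<open>
  The convective derivative in direction \<open>j\<close> splits into two parts. The second one depends on \<open>j\<close> only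
  through the sign \<open>(-1)\<^sup>j\<close> and therefore drops out of the sum over \<open>j\<close>. The first one is
  \<open>sn \<alpha> x i * cs \<alpha> x i\<close> times a difference of two products of squares, which the double-angle formulas turn into
  products of factors affine in the sine harmonics. In these products sine and cosine are exchanged at \<open>j\<close>;
  this is what the sign \<open>d\<close> records.
\<close>

lemma convective_term:
  fixes n i j :: nat and \<alpha> vr :: real and x :: point
  defines "A \<equiv> {1..n} - {i}"
  defines "t \<equiv> \<lambda>k. (-1) ^ k * sin (2 * \<alpha> * x k)"
  defines "d \<equiv> \<lambda>k. if k = j then -1 else 1"
  assumes "even n" "i \<in> {1..n}" "j \<in> {1..n}"
  shows "v0 n \<alpha> vr sym_phase j x * partial j (v0 n \<alpha> vr sym_phase i) x = \<alpha> * vr\<^sup>2 * (-1) ^ j *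
    (sn \<alpha> x i * cs \<alpha> x i * ((if j = i then -1 else 1) *
        ((\<Prod>k\<in>A. (1 + d k * t k) / 2) - (\<Prod>k\<in>A. (1 - d k * t k) / 2)))
     + ((cs \<alpha> x i)\<^sup>2 - (sn \<alpha> x i)\<^sup>2) * ((\<Prod>k\<in>A. sn \<alpha> x k) * (\<Prod>k\<in>A. cs \<alpha> x k)))"
proof (cases "j = i")
  case True
  have "(\<Prod>k\<in>A. (1 + d k * t k) / 2) = (\<Prod>k\<in>A. sn \<alpha> x k)\<^sup>2"
    "(\<Prod>k\<in>A. (1 - d k * t k) / 2) = (\<Prod>k\<in>A. cs \<alpha> x k)\<^sup>2"
    unfolding prod_power_distrib
    using True by (intro prod.cong; simp add: A_def d_def t_def double_angle_sn_cs)+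
  then show ?thesis
    unfolding partial_v0[OF assms(4-6)] v0_cofactors[OF assms(4) assms(6) assms(5)] cofactor_sn_def cofactor_cs_def
    using True by (simp add: A_def power2_eq_square algebra_simps)
next
  case False
  let ?B = "{1..n} - {i, j}"
  have AB: "(\<Prod>k\<in>A. f k) = f j * (\<Prod>k\<in>?B. f k)" for f :: "nat \<Rightarrow> real"
    unfolding A_def using prod_remove_second[OF assms(6) False] .
  have rest: "(\<Prod>k\<in>?B. (1 + d k * t k) / 2) = (\<Prod>k\<in>?B. sn \<alpha> x k)\<^sup>2"
    "(\<Prod>k\<in>?B. (1 - d k * t k) / 2) = (\<Prod>k\<in>?B. cs \<alpha> x k)\<^sup>2"
    unfolding prod_power_distrib
    by (intro prod.cong; simp add: d_def t_def double_angle_sn_cs)+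
  have flipped: "(1 + d j * t j) / 2 = (cs \<alpha> x j)\<^sup>2" "(1 - d j * t j) / 2 = (sn \<alpha> x j)\<^sup>2"
    by (simp_all add: d_def t_def double_angle_sn_cs)
  have swap: "{1..n} - {j, i} = ?B" by auto
  show ?thesis
    unfolding partial_v0[OF assms(4-6)] v0_cofactors[OF assms(4) assms(6) assms(5)]
      cofactor_sn_def cofactor_cs_def AB flipped rest swap
    using False by (simp add: power2_eq_square algebra_simps)
qed

text \<open>
  Expanding the products, the monomial of \<open>S\<close> receives from direction \<open>j\<close> the sign \<open>-1\<close> if \<open>j \<in> insert i S\<close> and \<open>1\<close>
  otherwise (for \<open>j = i\<close> this is the exceptional sign of the diagonal term). Weighting with \<open>(-1)\<^sup>j\<close> and
  summing over \<open>j\<close> leaves \<open>-2\<close> times the sum of signs over \<open>insert i S\<close>, because all signs together cancel.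
\<close>

lemma g0_sym_phase:
  assumes "even n" "i \<in> {1..n}"
  shows "g0 n \<alpha> vr sym_phase i = trig_sum n \<alpha> (conv_coeff n \<alpha> vr i) i"
proof
  fix x
  let ?A = "{1..n} - {i}"
  let ?t = "\<lambda>k. (-1) ^ k * sin (2 * \<alpha> * x k)"
  let ?w = "\<lambda>j S. if j \<in> insert i S then -1 else 1 :: real"
  let ?h = "\<lambda>j. (if j = i then -1 else 1) * ((\<Prod>k\<in>?A. (1 + (if k = j then -1 else 1) * ?t k) / 2)
     - (\<Prod>k\<in>?A. (1 - (if k = j then -1 else 1) * ?t k) / 2))"
  let ?R = "((cs \<alpha> x i)\<^sup>2 - (sn \<alpha> x i)\<^sup>2) * ((\<Prod>k\<in>?A. sn \<alpha> x k) * (\<Prod>k\<in>?A. cs \<alpha> x k))"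
  have n: "n \<ge> 2" using assms by (auto elim: evenE)
  have h: "?h j = (\<Sum>S\<in>Pow ?A. (if odd (card S) then ?w j S * (\<Prod>k\<in>S. ?t k) else 0)) / 2 ^ (n - 2)" for j
  proof -
    have "(if j = i then -1 else 1) * (\<Prod>k\<in>S. if k = j then -1 else 1) = ?w j S" if "S \<in> Pow ?A" for S
    proof -
      have "finite S" using that by (auto intro: finite_subset)
      then show ?thesis using that by (auto simp: prod.delta')
    qed
    then have "(if j = i then -1 else 1) * (\<Sum>S\<in>Pow ?A. (if odd (card S) then (\<Prod>k\<in>S. if k = j then -1 else 1) * (\<Prod>k\<in>S. ?t k) else 0))
       = (\<Sum>S\<in>Pow ?A. (if odd (card S) then ?w j S * (\<Prod>k\<in>S. ?t k) else 0))"
      unfolding sum_distrib_left by (intro sum.cong refl) (simp add: mult.assoc[symmetric])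
    moreover have "(2::real) ^ card ?A = 2 * 2 ^ (n - 2)"
      using assms(2) n by (simp flip: power_Suc)
    ultimately show ?thesis
      unfolding prod_half_diff_expansion[OF finite_Diff[OF finite_atLeastAtMost]]
      by (simp add: field_simps)
  qed
  have sum_w: "(\<Sum>j=1..n. (-1) ^ j * ?w j S) = - 2 * (\<Sum>k\<in>insert i S. (-1) ^ k)" if "S \<in> Pow ?A" for S
  proof -
    have sub: "insert i S \<subseteq> {1..n}" using that assms(2) by auto
    have "(\<Sum>j=1..n. (-1) ^ j * ?w j S) = (\<Sum>j=1..n. (-1) ^ j - 2 * (if j \<in> insert i S then (-1) ^ j else 0))"
      by (intro sum.cong) auto
    also have "\<dots> = - 2 * (\<Sum>j=1..n. if j \<in> insert i S then (-1) ^ j else 0)"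
      using sum_alternating_even[OF assms(1)] by (simp add: sum_subtractf sum_distrib_left sum_negf)
    also have "(\<Sum>j=1..n. if j \<in> insert i S then (-1) ^ j else 0) = (\<Sum>j\<in>insert i S. (-1) ^ j :: real)"
      using sub by (subst sum.inter_restrict[symmetric]) (auto simp only: finite_atLeastAtMost Int_absorb1)
    finally show ?thesis .
  qed
  have "g0 n \<alpha> vr sym_phase i x = (\<Sum>j=1..n. \<alpha> * vr\<^sup>2 * (-1) ^ j * (sn \<alpha> x i * cs \<alpha> x i * ?h j + ?R))"
    unfolding g0_def by (intro sum.cong refl convective_term assms)
  also have "\<dots> = \<alpha> * vr\<^sup>2 * (sn \<alpha> x i * cs \<alpha> x i) * (\<Sum>j=1..n. (-1) ^ j * ?h j)
      + \<alpha> * vr\<^sup>2 * ?R * (\<Sum>j=1..n. (-1) ^ j)"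
    unfolding distrib_left sum.distrib sum_distrib_left
    by (intro arg_cong2[where f="(+)"] sum.cong refl) (simp_all only: ac_simps)
  also have "\<dots> = \<alpha> * vr\<^sup>2 / 2 * cos (2 * \<alpha> * x i) * (\<Sum>j=1..n. (-1) ^ j * ?h j)"
    unfolding sum_alternating_even[OF assms(1)] double_angle_sn_cs(3) by simp
  also have "(\<Sum>j=1..n. (-1) ^ j * ?h j)
    = (\<Sum>j=1..n. \<Sum>S\<in>Pow ?A. (if odd (card S) then (-1) ^ j * ?w j S * (\<Prod>k\<in>S. ?t k) else 0)) / 2 ^ (n - 2)"
    unfolding h times_divide_eq_right sum_divide_distrib[symmetric] sum_distrib_left
    by (intro arg_cong2[where f="(/)"] sum.cong refl) auto
  also have "(\<Sum>j=1..n. \<Sum>S\<in>Pow ?A. (if odd (card S) then (-1) ^ j * ?w j S * (\<Prod>k\<in>S. ?t k) else 0))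
    = (\<Sum>S\<in>Pow ?A. \<Sum>j=1..n. (if odd (card S) then (-1) ^ j * ?w j S * (\<Prod>k\<in>S. ?t k) else 0))"
    by (rule sum.swap)
  also have "\<dots> = (\<Sum>S\<in>Pow ?A. if odd (card S) then (- 2 * (\<Sum>k\<in>insert i S. (-1) ^ k)) * (\<Prod>k\<in>S. ?t k) else 0)"
  proof (intro sum.cong refl)
    fix S assume S: "S \<in> Pow ?A"
    have "(\<Sum>j=1..n. (-1) ^ j * ?w j S * (\<Prod>k\<in>S. ?t k)) = - 2 * (\<Sum>k\<in>insert i S. (-1) ^ k) * (\<Prod>k\<in>S. ?t k)"
      unfolding sum_distrib_right[symmetric] sum_w[OF S] ..
    then show "(\<Sum>j=1..n. if odd (card S) then (-1) ^ j * ?w j S * (\<Prod>k\<in>S. ?t k) else 0)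
      = (if odd (card S) then - 2 * (\<Sum>k\<in>insert i S. (-1) ^ k) * (\<Prod>k\<in>S. ?t k) else 0)"
      by (cases "odd (card S)") (simp_all only: not_False_eq_True not_True_eq_False if_True if_False sum.neutral_const)
  qed
  finally have "g0 n \<alpha> vr sym_phase i x = cos (2 * \<alpha> * x i) * (\<Sum>S\<in>Pow ?A. \<alpha> * vr\<^sup>2 / 2 / 2 ^ (n - 2) *
      (if odd (card S) then (- 2 * (\<Sum>k\<in>insert i S. (-1) ^ k)) * (\<Prod>k\<in>S. ?t k) else 0))"
    by (simp only: sum_distrib_left[symmetric]) simp
  also have "\<dots> = trig_sum n \<alpha> (conv_coeff n \<alpha> vr i) i x"
    unfolding trig_sum_def conv_coeff_def
    by (rule arg_cong[where f="(*) _"], rule sum.cong[OF refl]) (simp add: prod.distrib)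
  finally show "g0 n \<alpha> vr sym_phase i x = trig_sum n \<alpha> (conv_coeff n \<alpha> vr i) i x" .
qed

section \<open>Pressure and curl\<close>

lemma derivative_within_half_line_unique:
  fixes f :: "real \<Rightarrow> real"
  assumes "(f has_real_derivative D) (at t within {0..})" "(f has_real_derivative E) (at t within {0..})" "t \<ge> 0"
  shows "D = E"
proof (rule vector_derivative_unique_within)
  have "at_right t \<le> at t within {0..}" using assms(3) by (intro at_le) auto
  then show "at t within {0..} \<noteq> bot" using trivial_limit_at_right_real[of t] by (auto simp: bot_unique)
qed (use assms(1,2) in \<open>auto simp: has_real_derivative_iff_has_vector_derivative\<close>)

text \<open>
  Each component of the field is an eigenfunction of the Laplacian, so exponential decay balances the
  viscous term exactly and the momentum equation reduces to \<open>\<nabla>p = - \<rho> e\<^sup>2 g\<close>, where \<open>e\<close> is the decay factor.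
  Time \<open>0\<close> gives one direction; multiplying a potential by \<open>e\<^sup>2\<close> gives the other.
\<close>

lemma navier_stokes_iff_gradient:
  fixes \<rho> \<kappa> \<alpha> vr :: real
  assumes "even n" "\<rho> > 0"
  shows "(\<exists>p. navier_stokes n \<rho> \<kappa> (\<lambda>i t x. v0 n \<alpha> vr sym_phase i x * exp (- real n * \<alpha>\<^sup>2 * \<kappa> * t)) p)
    \<longleftrightarrow> (\<exists>q. \<forall>i\<in>{1..n}. \<forall>x. has_partial i q (- \<rho> * g0 n \<alpha> vr sym_phase i x) x)"
proof -
  let ?v = "v0 n \<alpha> vr sym_phase" and ?g = "g0 n \<alpha> vr sym_phase"
  let ?c = "- real n * \<alpha>\<^sup>2 * \<kappa>"
  let ?e = "\<lambda>t. exp (?c * t)"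
  let ?V = "\<lambda>i t x. ?v i x * ?e t"
  have d1: "has_partial j (?V i t) (partial j (?v i) x * ?e t) x"
    if "i \<in> {1..n}" "j \<in> {1..n}" for i j t x
    using has_partial_mult_const[OF has_partial_v0[OF assms(1) that]] partial_v0[OF assms(1) that] by simp
  have p1: "partial j (?V i t) = (\<lambda>x. partial j (?v i) x * ?e t)"
    if "i \<in> {1..n}" "j \<in> {1..n}" for i j t
    using has_partial_imp_partial[OF d1[OF that]] by auto
  have d2: "has_partial j (partial j (?V i t)) (- \<alpha>\<^sup>2 * ?v i x * ?e t) x"
    if "i \<in> {1..n}" "j \<in> {1..n}" for i j t x
    unfolding p1[OF that] by (intro has_partial_mult_const has_partial_partial_v0 assms that)
  have laplace: "\<kappa> * (\<Sum>j=1..n. partial j (partial j (?V i t)) x) = ?v i x * (?c * ?e t)"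
    if "i \<in> {1..n}" for i t x
    using has_partial_imp_partial[OF d2[OF that]] by simp
  have convect: "(\<Sum>j=1..n. ?V j t x * partial j (?V i t) x) = ?g i x * (?e t)\<^sup>2"
    if "i \<in> {1..n}" for i t x
    unfolding g0_def sum_distrib_right
  proof (intro sum.cong refl)
    fix j assume "j \<in> {1..n}"
    then show "?V j t x * partial j (?V i t) x = ?v j x * partial j (?v i) x * (?e t)\<^sup>2"
      unfolding p1[OF that \<open>j \<in> {1..n}\<close>] by (simp add: power2_eq_square)
  qed
  have div: "(\<Sum>i=1..n. partial i (?V i t) x) = 0" for t x
    using divergence_v0[OF assms(1), of \<alpha> vr x] p1
    by (simp add: sum_distrib_right[symmetric])
  have momentum: "vt + (\<Sum>j=1..n. ?V j t x * partial j (?V i t) x)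
        = \<kappa> * (\<Sum>j=1..n. partial j (partial j (?V i t)) x) - px / \<rho> \<longleftrightarrow> px = - \<rho> * ?g i x * (?e t)\<^sup>2"
    if "i \<in> {1..n}" "vt = ?v i x * (?c * ?e t)" for i t x vt px
    unfolding laplace[OF that(1)] convect[OF that(1)] that(2) using assms(2)
    by (auto simp: field_simps)
  have dt: "((\<lambda>s. ?V i s x) has_real_derivative ?v i x * (?c * ?e t)) (at t within {0..})" for i x t
    by (auto intro!: derivative_eq_intros)
  show ?thesis
  proof
    assume "\<exists>p. navier_stokes n \<rho> \<kappa> ?V p"
    then obtain p where p: "navier_stokes n \<rho> \<kappa> ?V p" ..
    have "has_partial i (p 0) (- \<rho> * ?g i x) x" if i: "i \<in> {1..n}" for i x
    proof -
      obtain vt px where *: "((\<lambda>s. ?V i s x) has_real_derivative vt) (at 0 within {0..})"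
          "has_partial i (p 0) px x"
          "vt + (\<Sum>j=1..n. ?V j 0 x * partial j (?V i 0) x)
            = \<kappa> * (\<Sum>j=1..n. partial j (partial j (?V i 0)) x) - px / \<rho>"
        using p i unfolding navier_stokes_def by blast
      have "vt = ?v i x * (?c * ?e 0)"
        using derivative_within_half_line_unique[OF *(1) dt] by simp
      from *(3) have "px = - \<rho> * ?g i x * (?e 0)\<^sup>2"
        unfolding momentum[OF i \<open>vt = ?v i x * (?c * ?e 0)\<close>] .
      then show ?thesis using *(2) by simp
    qed
    then show "\<exists>q. \<forall>i\<in>{1..n}. \<forall>x. has_partial i q (- \<rho> * ?g i x) x" by blast
  next
    assume "\<exists>q. \<forall>i\<in>{1..n}. \<forall>x. has_partial i q (- \<rho> * ?g i x) x"
    then obtain q where q: "\<And>i x. i \<in> {1..n} \<Longrightarrow> has_partial i q (- \<rho> * ?g i x) x" by blast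
    have "navier_stokes n \<rho> \<kappa> ?V (\<lambda>t x. q x * (?e t)\<^sup>2)"
      unfolding navier_stokes_def
    proof (intro allI impI conjI ballI)
      fix t :: real and x i assume i: "i \<in> {1..n}"
      show "\<exists>vt px. ((\<lambda>s. ?V i s x) has_real_derivative vt) (at t within {0..}) \<and>
         has_partial i (\<lambda>x. q x * (?e t)\<^sup>2) px x \<and>
         vt + (\<Sum>j=1..n. ?V j t x * partial j (?V i t) x)
           = \<kappa> * (\<Sum>j=1..n. partial j (partial j (?V i t)) x) - px / \<rho>"
        by (intro exI conjI, rule dt, rule has_partial_mult_const[OF q[OF i]])
          (simp only: momentum[OF i refl])
      show "\<exists>D. has_partial j (?V i t) D x" "\<exists>D. has_partial j (partial j (?V i t)) D x"
        if "j \<in> {1..n}" for j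
        by (rule exI, rule d1[OF i that], rule exI, rule d2[OF i that])
    qed (rule div)
    then show "\<exists>p. navier_stokes n \<rho> \<kappa> ?V p"
      by (rule exI[of "navier_stokes n \<rho> \<kappa> ?V"])
  qed
qed

text \<open>
  The filter \<open>Q\<close> covers both the whole convective field and its part of higher degree. Curl-freeness in
  the coordinates \<open>i\<close> and \<open>j\<close> asks that, for all \<open>T\<close> of even size avoiding them, the coefficient of component \<open>i\<close> at \<open>insert j T\<close>
  equals that of component \<open>j\<close> at \<open>insert i T\<close>. For \<open>i\<close> and \<open>j\<close> of opposite parity these are opposite to each
  other, so the excess of \<open>T \<union> {i, j}\<close> would have to vanish. With six coordinates there is room for \<open>i = 1\<close>,
  \<open>j = 2\<close> and \<open>T = {3, 5}\<close>, where it is \<open>-2\<close>. The coordinates in \<open>{3, 5}\<close> are put at the angle where the sine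
  harmonic is \<open>1\<close>, the others at \<open>0\<close>.
\<close>

lemma not_curl_free_conv_coeff:
  fixes Q :: "nat \<Rightarrow> bool"
  assumes "even n" "n \<ge> 6" "\<alpha> \<noteq> 0" "vr \<noteq> 0" "Q 3"
  shows "\<not> curl_free n (\<lambda>i. trig_sum n \<alpha> (\<lambda>S. if Q (card S) then conv_coeff n \<alpha> vr i S else 0) i)"
    (is "\<not> curl_free n (\<lambda>i. trig_sum n \<alpha> (?c i) i)")
proof
  assume cf: "curl_free n (\<lambda>i. trig_sum n \<alpha> (?c i) i)"
  let ?x = "\<lambda>k. if k \<in> {3, 5} then pi / (4 * \<alpha>) else 0 :: real"
  have n: "1 \<in> {1..n}" "2 \<in> {1..n}" "{3, 5} \<subseteq> {1..n} - {1, 2}" "{3, 5} \<subseteq> {1..n} - {2, 1}"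
    using assms(2) by auto
  have Q3: "Q (Suc (Suc (Suc 0)))" using assms(5) by (simp add: numeral_3_eq_3)
  have Pow: "Pow {3, 5 :: nat} = {{}, {3}, {5}, {3, 5}}" by (auto simp: Pow_insert)
  have "trig_mixed n \<alpha> (?c 1) 1 2 ?x = 2 * (\<alpha> * vr\<^sup>2 / 2 ^ (n - 2))"
    unfolding trig_mixed_at_corner[OF assms(3) n(3)] Pow using Q3 by (simp add: conv_coeff_def)
  moreover have "trig_mixed n \<alpha> (?c 2) 2 1 ?x = - 2 * (\<alpha> * vr\<^sup>2 / 2 ^ (n - 2))"
    unfolding trig_mixed_at_corner[OF assms(3) n(4)] Pow using Q3 by (simp add: conv_coeff_def)
  moreover have "partial 2 (trig_sum n \<alpha> (?c 1) 1) ?x = partial 1 (trig_sum n \<alpha> (?c 2) 2) ?x"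
    using cf n(1,2) unfolding curl_free_def by blast
  ultimately show False
    using n(1,2) assms(3,4) by (simp add: partial_trig_sum)
qed

text \<open>
  Among four coordinates a set \<open>U\<close> of even size with nonzero excess consists of two coordinates of the same
  parity. Then the excess of \<open>U\<close> is \<open>(-1)\<^sup>i\<close> times its absolute value for every \<open>i \<in> U\<close>, which makes the coefficient
  a function of \<open>insert i S\<close> alone.
\<close>

lemma conv_coeff_potential_4:
  assumes "i \<in> {1..4}" "S \<subseteq> {1..4} - {i}"
  shows "conv_coeff 4 \<alpha> vr i S = (\<lambda>U. if even (card U)
    then - (\<alpha> * vr\<^sup>2 / 4) * (\<Prod>k\<in>U. (-1) ^ k) * \<bar>\<Sum>k\<in>U. (-1) ^ k\<bar> else 0) (insert i S)"
proof -
  have "{1..4} = {1, 2, 3, 4 :: nat}" by auto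
  then have "i \<in> {1, 2, 3, 4}" "S \<in> Pow ({1, 2, 3, 4} - {i})" using assms by auto
  then show ?thesis
    by (elim insertE; simp add: Pow_insert insert_Diff_if; elim disjE; simp add: conv_coeff_def)
qed

theorem theorem6p7:
  fixes n :: nat and \<alpha> vr \<rho> \<kappa> :: real
    and v g gb gm :: "nat \<Rightarrow> (nat \<Rightarrow> real) \<Rightarrow> real"
  assumes "n \<in> {4, 6, 8}" and "\<alpha> \<noteq> 0" and "vr \<noteq> 0" and "\<rho> > 0" and "\<kappa> > 0"
    and v_def: "v = v0 n \<alpha> vr sym_phase"
    and g_def: "g = g0 n \<alpha> vr sym_phase"
    and gb_def: "gb = bilinear_part n \<alpha> g"
    and gm_def: "gm = multilinear_part n \<alpha> g"
  shows "(\<forall>i\<in>{1..n}. \<exists>!c. multiple_angle_form n \<alpha> (g i) c)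
    \<and> (\<forall>i\<in>{1..n}. \<forall>x. g i x = gb i x + gm i x)
    \<and> (curl_free n g \<longleftrightarrow> n = 4)
    \<and> ((\<exists>p. navier_stokes n \<rho> \<kappa> (\<lambda>i t x. v i x * exp (- real n * \<alpha>\<^sup>2 * \<kappa> * t)) p) \<longleftrightarrow> n = 4)
    \<and> (n = 4 \<longrightarrow> (\<forall>i\<in>{1..n}. \<forall>x. gm i x = 0))
    \<and> (n = 6 \<or> n = 8 \<longrightarrow>
         (\<exists>i\<in>{1..n}. \<exists>x. gm i x \<noteq> 0)
       \<and> \<not> curl_free n gm
       \<and> \<not> (\<exists>p. \<forall>i\<in>{1..n}. \<forall>x. has_partial i p (- \<rho> * g i x) x))"
proof -
  let ?c = "conv_coeff n \<alpha> vr"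
  have n: "even n" "n \<noteq> 4 \<Longrightarrow> n \<ge> 6" using assms(1) by auto
  have g: "g i = trig_sum n \<alpha> (?c i) i" if "i \<in> {1..n}" for i
    unfolding g_def using n(1) that by (rule g0_sym_phase)
  have gm: "gm i = trig_sum n \<alpha> (\<lambda>S. if card S \<ge> 2 then ?c i S else 0) i" if "i \<in> {1..n}" for i
    unfolding gm_def using assms(2) that by (rule multilinear_part_trig_sum) (rule g[OF that])
  have cong: "curl_free n f = curl_free n h" if "\<And>i. i \<in> {1..n} \<Longrightarrow> f i = h i" for f h
    using that unfolding curl_free_def by (metis (no_types, lifting))
  have form: "\<exists>!c. multiple_angle_form n \<alpha> (g i) c" if "i \<in> {1..n}" for i
    unfolding g[OF that]
    using trig_sum_multiple_angle_form[OF that] multiple_angle_form_unique[OF assms(2)] by blast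
  have decomposition: "g i x = gb i x + gm i x" if "i \<in> {1..n}" for i x
    unfolding gb_def gm_def using assms(2) that
    by (rule degree_decomposition_trig_sum[where c="?c i"]) (use g[OF that] in \<open>auto simp: conv_coeff_def\<close>)
  have gradient: "\<exists>p. \<forall>i\<in>{1..n}. \<forall>x. has_partial i p (C * g i x) x" if "n = 4" for C
  proof -
    define p where "p = (\<lambda>x. (\<Sum>U\<in>Pow {1..4}. (if even (card U)
      then - (\<alpha> * vr\<^sup>2 / 4) * (\<Prod>k\<in>U. (-1) ^ k) * \<bar>\<Sum>k\<in>U. (-1) ^ k\<bar> else 0)
      * (\<Prod>k\<in>U. sin (2 * \<alpha> * x k))) / (2 * \<alpha>))"
    have "has_partial i p (g i x) x" if "i \<in> {1..n}" for i x
      unfolding g[OF that] p_def unfolding \<open>n = 4\<close>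
      by (rule trig_potential[OF assms(2)]) (use that \<open>n = 4\<close> conv_coeff_potential_4 in auto)
    then have "has_partial i (\<lambda>x. p x * C) (C * g i x) x" if "i \<in> {1..n}" for i x
      using has_partial_mult_const[of i p "g i x" x C] that by (simp add: mult.commute)
    then show ?thesis by blast
  qed
  have curl_of_gradient: "curl_free n g"
    if p: "\<forall>i\<in>{1..n}. \<forall>x. has_partial i p (C * g i x) x" and "C \<noteq> 0" for p C
  proof -
    have "has_partial i (\<lambda>x. p x * (1 / C)) (trig_sum n \<alpha> (?c i) i x) x" if i: "i \<in> {1..n}" for i x
    proof -
      have "has_partial i p (C * g i x) x" using p i by blast
      from has_partial_mult_const[OF this, of "1 / C"] show ?thesis
        using \<open>C \<noteq> 0\<close> by (simp add: g[OF i])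
    qed
    then have "curl_free n (\<lambda>i. trig_sum n \<alpha> (?c i) i)"
      by (rule trig_gradient_curl_free[OF assms(2)])
    then show ?thesis using cong[of g "\<lambda>i. trig_sum n \<alpha> (?c i) i"] g by blast
  qed
  have curl: "curl_free n g \<longleftrightarrow> n = 4"
  proof
    assume "n = 4"
    then show "curl_free n g" using gradient[of 1] curl_of_gradient[of _ 1] by fastforce
  next
    assume *: "curl_free n g"
    show "n = 4"
    proof (rule ccontr)
      assume "n \<noteq> 4"
      then have "\<not> curl_free n (\<lambda>i. trig_sum n \<alpha> (?c i) i)"
        using not_curl_free_conv_coeff[OF n(1) n(2) assms(2,3), of "\<lambda>_. True"] by simp
      then show False using * cong[of g "\<lambda>i. trig_sum n \<alpha> (?c i) i"] g by blast
    qed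
  qed
  have conservative: "(\<exists>p. \<forall>i\<in>{1..n}. \<forall>x. has_partial i p (- \<rho> * g i x) x) \<longleftrightarrow> n = 4"
    using gradient[of "- \<rho>"] curl_of_gradient[of _ "- \<rho>"] curl assms(4) by fastforce
  then have unforced: "(\<exists>p. navier_stokes n \<rho> \<kappa> (\<lambda>i t x. v i x * exp (- real n * \<alpha>\<^sup>2 * \<kappa> * t)) p) \<longleftrightarrow> n = 4"
    unfolding v_def navier_stokes_iff_gradient[OF n(1) assms(4)] g_def .
  have gm_4: "gm i x = 0" if "n = 4" "i \<in> {1..n}" for i x
  proof -
    have "(if card S \<ge> 2 then ?c i S else 0) = 0" if "S \<in> Pow ({1..n} - {i})" for S
    proof (cases "odd (card S) \<and> card S \<ge> 2")
      case True
      \<comment> \<open>The only odd size above one is three: all other coordinates, whose signs and that of \<open>i\<close> cancel.\<close>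
      have "card ({1..n} - {i}) = 3" using \<open>n = 4\<close> \<open>i \<in> {1..n}\<close> by simp
      moreover have "card S \<le> card ({1..n} - {i})" using that by (intro card_mono) auto
      ultimately have "card S = card ({1..n} - {i})" using True by presburger
      then have "S = {1..n} - {i}" using that by (intro card_subset_eq) auto
      then have "insert i S = {1..n}" using \<open>i \<in> {1..n}\<close> by auto
      then show ?thesis using sum_alternating_even[OF n(1)] by (simp add: conv_coeff_def)
    qed (auto simp: conv_coeff_def)
    then show ?thesis unfolding gm[OF that(2)] trig_sum_def by simp
  qed
  have gm_curl: "\<not> curl_free n gm" if "n \<noteq> 4"
    using not_curl_free_conv_coeff[OF n(1) n(2)[OF that] assms(2,3), of "\<lambda>k. k \<ge> 2"]
      cong[of gm "\<lambda>i. trig_sum n \<alpha> (\<lambda>S. if card S \<ge> 2 then ?c i S else 0) i"] gm by simp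
  have gm_nonzero: "\<exists>i\<in>{1..n}. \<exists>x. gm i x \<noteq> 0" if "n \<noteq> 4"
  proof (rule ccontr)
    assume "\<not> ?thesis"
    then have "curl_free n gm" by (simp add: curl_free_def partial_def)
    then show False using gm_curl[OF that] by simp
  qed
  show ?thesis
    using form decomposition curl unforced gm_4 gm_curl gm_nonzero conservative by auto
qed

end
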